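(* Let $\kappa>0$, $a>0$, and let $u=u(\cdot;u_0)$ be a solution of $$\frac{u''(r)}{(1-u'(r)^2)^{3/2}}=\kappa\,u(r),\quad -a<r<a,\qquad u'(\pm a)=\pm\tanh\beta ,$$ with $|u'|<1$, $u(0)=u_0$ and $u'(0)=0$, where $u_0>0$ is the lowest height (minimum value) of $u$. Then $$u_0-\frac{1}{\kappa u_0}+\sqrt{a^2+\frac{1}{\kappa^2u_0^2}}<u(a)<u_0+a\,\frac{\cosh\beta-1}{\sinh\beta}.$$
   Context: $u(\cdot;u_0)$ denotes the unique solution on $\mathbb{R}$ of $\dfrac{u''}{(1-u'^2)^{3/2}}=\kappa u$ with $u(0)=u_0$, $u'(0)=0$. The real number $\beta$ is determined by $u'(a)=\tanh\beta$, and $\beta>0$ since $u_0>0$. *)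

theory Defs
  imports Complex_Main
begin

end

theory Submission imports Defs begin

text \<open>
  Let \<open>w = u' / sqrt (1 - u'\<^sup>2)\<close>; with \<open>u' = tanh \<psi>\<close> this is \<open>sinh \<psi>\<close>. The equation says
  \<open>w' = \<kappa> u\<close>, and the bounds on \<open>u\<close> come from squeezing \<open>w\<close> between two lines through the origin
  and integrating.

  Since \<open>u \<ge> u0\<close>, \<open>w\<close> has slope at least \<open>\<kappa> u0\<close>, so it is positive to the right of \<open>0\<close>, and \<open>u\<close>
  is strictly increasing there. Hence \<open>w' = \<kappa> u\<close> is strictly increasing too: \<open>w\<close> is strictly convex
  and lies above its tangent at the origin and below its chord over \<open>[0, a]\<close>,
  \<open>\<kappa> u0 r < w r < (sinh \<beta> / a) r\<close> for \<open>0 < r < a\<close>.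

  Undoing the substitution, \<open>u' = w / sqrt (1 + w\<^sup>2)\<close> is a strictly increasing function of \<open>w\<close>. For a
  line \<open>w = c r\<close> it is the slope of the hyperbola \<open>sqrt (1 + (c r)\<^sup>2) / c\<close>, a curve of constant
  curvature \<open>c\<close> in the Minkowski plane. Comparing \<open>u\<close> with the hyperbolas for \<open>c = \<kappa> u0\<close> and
  \<open>c = sinh \<beta> / a\<close> gives the two bounds.

  The hypotheses do not say that \<open>u'\<close> is continuous at \<open>a\<close>, so the chord is not obtained directly by
  letting \<open>r\<close> tend to \<open>a\<close> in \<open>w r\<close>. What is used instead is that the one-sided derivative at \<open>a\<close> of a
  function with increasing derivative dominates the derivative before \<open>a\<close>
  (\<open>increasing_derivative_le_at_right_end\<close>).
\<close>

section \<open>Slope and hyperbolic sine of the rapidity\<close>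

text \<open>The slope \<open>tanh \<psi>\<close> of a spacelike line in terms of \<open>y = sinh \<psi>\<close>.\<close>

definition slope_of_sinh :: "real \<Rightarrow> real" where
  "slope_of_sinh y = y / sqrt (1 + y\<^sup>2)"

text \<open>Conversely, \<open>sinh \<psi>\<close> in terms of the slope \<open>x = tanh \<psi>\<close>, for \<open>\<bar>x\<bar> < 1\<close>.\<close>

definition sinh_of_slope :: "real \<Rightarrow> real" where
  "sinh_of_slope x = x / sqrt (1 - x\<^sup>2)"

lemma sinh_of_slope_0 [simp]: "sinh_of_slope 0 = 0"
  by (simp add: sinh_of_slope_def)

lemma slope_of_sinh_sinh: "slope_of_sinh (sinh \<beta>) = tanh \<beta>"
proof -
  have "sqrt (1 + (sinh \<beta>)\<^sup>2) = cosh \<beta>"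
    by (rule real_sqrt_unique) (simp_all add: cosh_square_eq)
  then show ?thesis
    by (simp add: slope_of_sinh_def tanh_def)
qed

lemma slope_of_sinh_of_slope:
  assumes "\<bar>x\<bar> < 1"
  shows "slope_of_sinh (sinh_of_slope x) = x"
proof -
  have x2: "x\<^sup>2 < 1"
    using assms by (simp add: abs_square_less_1)
  have "1 + (sinh_of_slope x)\<^sup>2 = 1 / (1 - x\<^sup>2)"
    using x2 by (simp add: sinh_of_slope_def power_divide field_simps)
  then show ?thesis
    using x2 by (simp add: slope_of_sinh_def sinh_of_slope_def real_sqrt_divide)
qed

lemma strict_mono_slope_of_sinh: "strict_mono slope_of_sinh"
proof (rule strict_monoI)
  fix x y :: real
  assume "x < y"
  then show "slope_of_sinh x < slope_of_sinh y"
  proof (rule DERIV_pos_imp_increasing)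
    fix z :: real
    define s where "s = sqrt (1 + z\<^sup>2)"
    have p: "1 + z\<^sup>2 > 0" by (simp add: add_pos_nonneg)
    then have s: "s > 0" "s * s = 1 + z\<^sup>2" by (simp_all add: s_def)
    have "(slope_of_sinh has_real_derivative (1 * s - z * (2 * z / (2 * s))) / (s * s)) (at z)"
      unfolding slope_of_sinh_def [abs_def] s_def
      using p by (auto intro!: derivative_eq_intros simp: field_simps)
    moreover have "1 * s - z * (2 * z / (2 * s)) = 1 / s"
      using s by (simp add: field_simps power2_eq_square)
    ultimately show "\<exists>d. (slope_of_sinh has_real_derivative d) (at z) \<and> d > 0"
      using s p by (intro exI[of _ "1 / s / (s * s)"]) simp
  qed
qed

lemma slope_of_sinh_less_iff: "slope_of_sinh x < slope_of_sinh y \<longleftrightarrow> x < y"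
  by (rule strict_mono_less [OF strict_mono_slope_of_sinh])

text \<open>This turns the curvature operator \<open>u'' / (1 - u'\<^sup>2)\<^bsup>3/2\<^esup>\<close> into a plain derivative.\<close>

lemma has_real_derivative_sinh_of_slope:
  assumes "\<bar>x\<bar> < 1"
  shows "(sinh_of_slope has_real_derivative 1 / (1 - x\<^sup>2) powr (3/2)) (at x)"
proof -
  define s where "s = sqrt (1 - x\<^sup>2)"
  have p: "1 - x\<^sup>2 > 0"
    using assms by (simp add: abs_square_less_1)
  then have s: "s > 0" "s * s = 1 - x\<^sup>2" by (simp_all add: s_def)
  have "(sinh_of_slope has_real_derivative (1 * s - x * (- (2 * x) / (2 * s))) / (s * s)) (at x)"
    unfolding sinh_of_slope_def [abs_def] s_def
    using p by (auto intro!: derivative_eq_intros simp: field_simps)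
  moreover have "1 * s - x * (- (2 * x) / (2 * s)) = 1 / s"
    using s by (simp add: field_simps power2_eq_square)
  moreover have "(1 - x\<^sup>2) powr (3/2) = s * (s * s)"
  proof -
    have "(1 - x\<^sup>2) powr (3/2) = (1 - x\<^sup>2) powr (1/2 + 1)" by simp
    also have "\<dots> = s * (1 - x\<^sup>2)"
      using p by (subst powr_add) (simp add: powr_half_sqrt s_def)
    finally show ?thesis using s by simp
  qed
  ultimately show ?thesis by simp
qed

text \<open>The hyperbola whose slope at \<open>r\<close> corresponds to the line \<open>w = c r\<close>.\<close>

lemma has_real_derivative_hyperbola:
  assumes "c > 0"
  shows "((\<lambda>r. sqrt (1 + (c * r)\<^sup>2) / c) has_real_derivative slope_of_sinh (c * r)) (at r)"
proof -
  have p: "1 + (c * r)\<^sup>2 > 0" by (simp add: add_pos_nonneg)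
  show ?thesis
    unfolding slope_of_sinh_def
    using p assms by (auto intro!: derivative_eq_intros simp: field_simps power2_eq_square)
qed

section \<open>Comparison from derivatives\<close>

lemma increment_less_of_derivative_less:
  fixes f g f' g' :: "real \<Rightarrow> real"
  assumes "a < b"
    and "continuous_on {a..b} f" "continuous_on {a..b} g"
    and "\<And>x. a < x \<Longrightarrow> x < b \<Longrightarrow> (f has_real_derivative f' x) (at x)"
    and "\<And>x. a < x \<Longrightarrow> x < b \<Longrightarrow> (g has_real_derivative g' x) (at x)"
    and "\<And>x. a < x \<Longrightarrow> x < b \<Longrightarrow> f' x < g' x"
  shows "f b - f a < g b - g a"
proof -
  have "g a - f a < g b - f b"
  proof (rule DERIV_pos_imp_increasing_open [OF \<open>a < b\<close>])
    fix x assume x: "a < x" "x < b"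
    show "\<exists>d. ((\<lambda>x. g x - f x) has_real_derivative d) (at x) \<and> d > 0"
      using assms(4-6) [OF x] by (intro exI[of _ "g' x - f' x"]) (simp add: DERIV_diff)
  qed (intro continuous_intros assms)
  then show ?thesis by simp
qed

text \<open>
  Near \<open>b\<close>, the mean value theorem bounds the difference quotients that define the left derivative
  at \<open>b\<close> from below by \<open>f' s\<close>.
\<close>

lemma increasing_derivative_le_at_right_end:
  fixes f f' :: "real \<Rightarrow> real"
  assumes "a < s" "s < b"
    and cont: "continuous_on {a..b} f"
    and df: "\<And>x. a < x \<Longrightarrow> x < b \<Longrightarrow> (f has_real_derivative f' x) (at x)"
    and incr: "\<And>x y. a < x \<Longrightarrow> x < y \<Longrightarrow> y < b \<Longrightarrow> f' x \<le> f' y"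
    and dfb: "(f has_real_derivative d) (at b within {a..b})"
  shows "f' s \<le> d"
proof -
  have quotient: "f' s \<le> (f r - f b) / (r - b)" if r: "s < r" "r < b" for r
  proof -
    have "continuous_on {r..b} f"
      by (rule continuous_on_subset [OF cont]) (use assms(1) r in auto)
    moreover have "f differentiable at x" if "r < x" "x < b" for x
      using df[of x] assms(1) r that by (auto simp: real_differentiable_def)
    ultimately obtain l z where z: "r < z" "z < b" "(f has_real_derivative l) (at z)"
        and lz: "f b - f r = (b - r) * l"
      using MVT [OF r(2), of f] by blast
    have "l = f' z"
      using DERIV_unique [OF z(3) df] z assms(1) r by simp
    then have "f' s \<le> l"
      using incr[of s z] z assms(1) r by simp
    moreover have "(f r - f b) / (r - b) = l"
      using lz r by (simp add: field_simps)
    ultimately show ?thesis by simp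
  qed
  have "((\<lambda>r. (f r - f b) / (r - b)) \<longlongrightarrow> d) (at b within {a..b})"
    using dfb by (simp add: has_field_derivative_iff)
  moreover have "at b within {a..b} = at_left b"
    using assms(1,2) by (simp add: at_within_Icc_at_left)
  ultimately have "((\<lambda>r. (f r - f b) / (r - b)) \<longlongrightarrow> d) (at_left b)" by simp
  then show ?thesis
  proof (rule tendsto_lowerbound)
    show "\<forall>\<^sub>F r in at_left b. f' s \<le> (f r - f b) / (r - b)"
      using quotient assms(2) unfolding eventually_at_left_field by blast
  qed simp
qed

section \<open>Bounds for the capillary height at the wall\<close>

theorem theorem5p2:
  fixes \<kappa> a \<beta> u0 :: real
    and u u' u'' :: "real \<Rightarrow> real"
  assumes "\<kappa> > 0" and "a > 0"
    and du: "\<And>r. r \<in> {-a..a} \<Longrightarrow> (u has_real_derivative u' r) (at r within {-a..a})"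
    and ddu: "\<And>r. r \<in> {-a<..<a} \<Longrightarrow> (u' has_real_derivative u'' r) (at r)"
    and spacelike: "\<And>r. r \<in> {-a..a} \<Longrightarrow> \<bar>u' r\<bar> < 1"
    and ode: "\<And>r. r \<in> {-a<..<a} \<Longrightarrow> u'' r / (1 - (u' r)\<^sup>2) powr (3/2) = \<kappa> * u r"
    and bdry: "u' a = tanh \<beta>" "u' (- a) = - tanh \<beta>"
    and init: "u 0 = u0" "u' 0 = 0"
    and "u0 > 0"
    and lowest: "\<And>r. r \<in> {-a..a} \<Longrightarrow> u0 \<le> u r"
  shows "u0 - 1 / (\<kappa> * u0) + sqrt (a\<^sup>2 + 1 / (\<kappa>\<^sup>2 * u0\<^sup>2)) < u a
       \<and> u a < u0 + a * ((cosh \<beta> - 1) / sinh \<beta>)"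
proof -
  define w where "w r = sinh_of_slope (u' r)" for r
  have w0: "w 0 = 0"
    by (simp add: w_def init)
  have u'_w: "u' r = slope_of_sinh (w r)" if "r \<in> {-a..a}" for r
    unfolding w_def using slope_of_sinh_of_slope [OF spacelike [OF that]] by simp
  have dw: "(w has_real_derivative \<kappa> * u r) (at r)" if r: "r \<in> {-a<..<a}" for r
  proof -
    have "\<bar>u' r\<bar> < 1" using spacelike r by simp
    from DERIV_chain2 [OF has_real_derivative_sinh_of_slope [OF this] ddu [OF r]]
    show ?thesis
      unfolding w_def using ode [OF r] by simp
  qed
  have du_at: "(u has_real_derivative u' r) (at r)" if "r \<in> {-a<..<a}" for r
    using du[of r] that at_within_Icc_at[of "-a" r a] by simp
  have cont_u: "continuous_on {0..s} u" if "s \<le> a" for s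
  proof (rule continuous_on_subset)
    show "continuous_on {-a..a} u"
      by (rule DERIV_continuous_on) (use du in auto)
  qed (use that \<open>a > 0\<close> in auto)
  have cont_w: "continuous_on {r..s} w" if "-a < r" "s < a" for r s
    by (rule DERIV_continuous_on [where D = "\<lambda>r. \<kappa> * u r"])
       (use that in \<open>auto intro!: has_field_derivative_at_within [OF dw]\<close>)
  have w_slope: "\<exists>z. x < z \<and> z < y \<and> w y - w x = (y - x) * (\<kappa> * u z)"
    if "0 \<le> x" "x < y" "y < a" for x y
    using MVT2 [of x y w "\<lambda>r. \<kappa> * u r"] dw that by auto

  have w_less: "w x < w y" if xy: "0 \<le> x" "x < y" "y < a" for x y
  proof -
    obtain z where z: "x < z" "z < y" "w y - w x = (y - x) * (\<kappa> * u z)"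
      using w_slope [OF xy] by blast
    then have "u z > 0" using lowest[of z] \<open>u0 > 0\<close> xy by simp
    then have "(y - x) * (\<kappa> * u z) > 0" using xy \<open>\<kappa> > 0\<close> by simp
    then show ?thesis using z by simp
  qed
  have u'_less: "u' x < u' y" if "0 \<le> x" "x < y" "y < a" for x y
    using w_less [OF that] that by (simp add: u'_w slope_of_sinh_less_iff)
  have u_less: "u x < u y" if xy: "0 \<le> x" "x < y" "y < a" for x y
  proof (rule DERIV_pos_imp_increasing_open [OF xy(2)])
    fix r assume r: "x < r" "r < y"
    then have "u' r > 0" using u'_less[of 0 r] xy init by simp
    then show "\<exists>d. (u has_real_derivative d) (at r) \<and> d > 0"
      using du_at[of r] r xy by auto
  next
    show "continuous_on {x..y} u"
      by (rule continuous_on_subset [OF cont_u[of y]]) (use xy in auto)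
  qed

  have tangent: "\<kappa> * u0 * r < w r" if r: "0 < r" "r < a" for r
  proof -
    obtain z where z: "0 < z" "z < r" "w r = r * (\<kappa> * u z)"
      using w_slope[of 0 r] r w0 by auto
    have "u0 < u z" using u_less[of 0 z] z r init by simp
    then show ?thesis using z r \<open>\<kappa> > 0\<close> by (simp add: ac_simps)
  qed

  \<comment> \<open>Convexity: the slope over \<open>[x, y]\<close> exceeds that over \<open>[0, x]\<close>.\<close>
  have ratio: "w x * y < w y * x" if xy: "0 < x" "x < y" "y < a" for x y
  proof -
    obtain z where z: "0 < z" "z < x" "w x = x * (\<kappa> * u z)"
      using w_slope[of 0 x] xy w0 by auto
    obtain t where t: "x < t" "t < y" "w y - w x = (y - x) * (\<kappa> * u t)"
      using w_slope[of x y] xy by auto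
    have "\<kappa> * u z < \<kappa> * u t" using u_less[of z t] z t xy \<open>\<kappa> > 0\<close> by simp
    then have "x * ((y - x) * (\<kappa> * u z)) < x * ((y - x) * (\<kappa> * u t))" using xy by simp
    also have "\<dots> = x * (w y - w x)" using t by simp
    finally have "(y - x) * w x < x * (w y - w x)" using z by (simp add: ac_simps)
    then show ?thesis by (simp add: algebra_simps)
  qed

  have w_le: "w s \<le> sinh \<beta>" if s: "0 < s" "s < a" for s
  proof -
    have "u' s \<le> u' a"
    proof (rule increasing_derivative_le_at_right_end [where f = u and f' = u', OF s cont_u])
      show "(u has_real_derivative u' a) (at a within {0..a})"
        by (rule DERIV_subset [OF du]) (use \<open>a > 0\<close> in auto)
    qed (use du_at u'_less in \<open>auto intro: less_imp_le\<close>)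
    then have "slope_of_sinh (w s) \<le> slope_of_sinh (sinh \<beta>)"
      using u'_w[of s] s bdry by (simp add: slope_of_sinh_sinh)
    then show ?thesis
      by (meson not_le slope_of_sinh_less_iff)
  qed
  have sinh_pos: "sinh \<beta> > 0"
  proof -
    have "0 < w (a/2)" using w_less[of 0 "a/2"] w0 \<open>a > 0\<close> by simp
    also have "\<dots> \<le> sinh \<beta>" using w_le[of "a/2"] \<open>a > 0\<close> by simp
    finally show ?thesis .
  qed

  \<comment> \<open>The chord over \<open>[0, a]\<close> lies above \<open>w\<close>: weakly by letting \<open>y\<close> tend to \<open>a\<close> in \<open>ratio\<close>, and
    strictly because \<open>w r / r\<close> is strictly smaller than its value at a point between \<open>r\<close> and \<open>a\<close>.\<close>
  have chord_weak: "w r * a \<le> sinh \<beta> * r" if r: "0 < r" "r < a" for r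
  proof (rule tendsto_upperbound)
    show "((\<lambda>y. w r * y) \<longlongrightarrow> w r * a) (at_left a)"
      by (intro tendsto_intros)
    have "w r * y \<le> sinh \<beta> * r" if y: "r < y" "y < a" for y
    proof -
      have "w r * y < w y * r" using ratio r(1) y by blast
      also have "\<dots> \<le> sinh \<beta> * r" using w_le[of y] r y by (intro mult_right_mono) auto
      finally show ?thesis by simp
    qed
    then show "\<forall>\<^sub>F y in at_left a. w r * y \<le> sinh \<beta> * r"
      unfolding eventually_at_left_field using r by blast
  qed simp
  have chord: "w r < sinh \<beta> / a * r" if r: "0 < r" "r < a" for r
  proof -
    obtain t where t: "r < t" "t < a" using dense r by blast
    have "(w r * t) * a < (w t * r) * a" using ratio[of r t] r t \<open>a > 0\<close> by simp
    also have "\<dots> \<le> (sinh \<beta> * t) * r"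
      using mult_right_mono [OF chord_weak[of t], of r] r t by (simp add: ac_simps)
    finally have "t * (w r * a) < t * (sinh \<beta> * r)" by (simp add: ac_simps)
    then have "w r * a < sinh \<beta> * r" using r t by simp
    then show ?thesis using \<open>a > 0\<close> by (simp add: field_simps)
  qed

  have cont_hyp: "continuous_on {0..a} (\<lambda>r. sqrt (1 + (c * r)\<^sup>2) / c)" if "c > 0" for c
    by (intro continuous_intros) (use that in auto)

  define c where "c = \<kappa> * u0"
  have c: "c > 0" using \<open>\<kappa> > 0\<close> \<open>u0 > 0\<close> by (simp add: c_def)
  have "sqrt (1 + (c * a)\<^sup>2) / c - sqrt (1 + (c * 0)\<^sup>2) / c < u a - u 0"
  proof (rule increment_less_of_derivative_less [OF \<open>a > 0\<close> cont_hyp [OF c] cont_u])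
    show "slope_of_sinh (c * r) < u' r" if "0 < r" "r < a" for r
      using tangent [OF that] that by (simp add: u'_w slope_of_sinh_less_iff c_def)
  qed (use du_at has_real_derivative_hyperbola [OF c] in auto)
  moreover have "sqrt (a\<^sup>2 + 1 / (\<kappa>\<^sup>2 * u0\<^sup>2)) = sqrt (1 + (c * a)\<^sup>2) / c"
  proof -
    have "a\<^sup>2 + 1 / (\<kappa>\<^sup>2 * u0\<^sup>2) = (1 + (c * a)\<^sup>2) / c\<^sup>2"
      using \<open>\<kappa> > 0\<close> \<open>u0 > 0\<close> by (simp add: c_def power_mult_distrib field_simps)
    then show ?thesis using c by (simp add: real_sqrt_divide)
  qed
  ultimately have lower: "u0 - 1 / (\<kappa> * u0) + sqrt (a\<^sup>2 + 1 / (\<kappa>\<^sup>2 * u0\<^sup>2)) < u a"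
    using init by (simp add: c_def)

  define d where "d = sinh \<beta> / a"
  have d: "d > 0" using sinh_pos \<open>a > 0\<close> by (simp add: d_def)
  have "u a - u 0 < sqrt (1 + (d * a)\<^sup>2) / d - sqrt (1 + (d * 0)\<^sup>2) / d"
  proof (rule increment_less_of_derivative_less [OF \<open>a > 0\<close> cont_u cont_hyp [OF d]])
    show "u' r < slope_of_sinh (d * r)" if "0 < r" "r < a" for r
      using chord [OF that] that by (simp add: u'_w slope_of_sinh_less_iff d_def)
  qed (use du_at has_real_derivative_hyperbola [OF d] in auto)
  moreover have "sqrt (1 + (d * a)\<^sup>2) = cosh \<beta>"
    using \<open>a > 0\<close> by (intro real_sqrt_unique) (simp_all add: d_def cosh_square_eq)
  ultimately have "u a - u0 < (cosh \<beta> - 1) / d"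
    using init by (simp add: diff_divide_distrib)
  then have upper: "u a < u0 + a * ((cosh \<beta> - 1) / sinh \<beta>)"
    by (simp add: d_def ac_simps)

  from lower upper show ?thesis by blast
qed

end
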